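(* Let $\theta_1\in\mathbb{R}$, let $z_1=e^{i\theta_1}$, and consider the inner analytic function $$w_\delta(z,z_1)=\frac{1}{2\pi}-\frac{1}{\pi}\,\frac{z}{z-z_1},\qquad |z|<1 .$$ Write $z=\rho e^{i\theta}$ with $0\le\rho<1$, and let $u_\delta(\rho,\theta,\theta_1)$ be the real part of $w_\delta(z,z_1)$. Then the $\rho\to1_{(-)}$ limit of $u_\delta(\rho,\theta,\theta_1)$ converges to the generalized function $\delta(\theta-\theta_1)$ (the Dirac delta "function" on the unit circle), that is, the following four conditions hold. 1. For every $\theta\not\equiv\theta_1 \pmod{2\pi}$, $\lim_{\rho\to1_{(-)}}u_\delta(\rho,\theta,\theta_1)=0$. 2. $\lim_{\rho\to1_{(-)}}u_\delta(\rho,\theta_1,\theta_1)=+\infty$. 3. For every open interval $(a,b)$ of the unit circle containing $\theta_1$, $$\lim_{\rho\to1_{(-)}}\int_a^b u_\delta(\rho,\theta,\theta_1)\,d\theta=1 .$$ 4. For every continuous integrable real function $g(\theta)$ on the unit circle whose corresponding inner analytic function $w_\gamma(z)$ has a finite limit as $z\to z_1$ from within the open unit disk, and for every open interval $(a,b)$ of the unit circle containing $\theta_1$, $$\lim_{\rho\to1_{(-)}}\int_a^b g(\theta)\,u_\delta(\rho,\theta,\theta_1)\,d\theta=g(\theta_1).$$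
   Context: An inner analytic function is a complex function that is analytic in the open unit disk $\{|z|<1\}$. Real functions on the unit circle are $2\pi$-periodic functions of the angle $\theta$; an open interval $(a,b)$ of the unit circle containing $\theta_1$ means $a<\theta_1<b$ with $b-a\le 2\pi$. The notation $\rho\to1_{(-)}$ means that $\rho$ tends to $1$ from below. The inner analytic function corresponding to an integrable real function $g$ on the unit circle is $$w_\gamma(z)=\sum_{k=0}^{\infty}c_kz^k,\qquad c_0=\frac{\alpha_0}{2},\quad c_k=\alpha_k-i\beta_k\ (k\ge1),$$ where $\alpha_k=\frac1\pi\int_{-\pi}^{\pi}g(\theta)\cos(k\theta)\,d\theta$ and $\beta_k=\frac1\pi\int_{-\pi}^{\pi}g(\theta)\sin(k\theta)\,d\theta$ are the Fourier coefficients of $g$. The symbol $\delta(\theta-\theta_1)$ denotes a limiting process (here $\rho\to1_{(-)}$) satisfying the four conditions listed; an integral containing $\delta(\theta-\theta_1)$ is understood as the limit of the integrals with $\delta(\theta-\theta_1)$ replaced by $u_\delta(\rho,\theta,\theta_1)$. *)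

theory Defs
  imports "HOL-Complex_Analysis.Complex_Analysis"
begin

definition inner_analytic :: "(complex \<Rightarrow> complex) \<Rightarrow> bool" where
  "inner_analytic w \<longleftrightarrow> w analytic_on ball 0 1"

text \<open>Real functions on the unit circle are represented by \<open>2\<pi>\<close>-periodic functions of the
  angle, defined on all of \<open>\<real>\<close>.\<close>

definition circle_periodic :: "(real \<Rightarrow> real) \<Rightarrow> bool" where
  "circle_periodic g \<longleftrightarrow> (\<forall>\<theta>. g (\<theta> + 2 * pi) = g \<theta>)"

definition circle_integrable :: "(real \<Rightarrow> real) \<Rightarrow> bool" where
  "circle_integrable g \<longleftrightarrow> circle_periodic g \<and> set_integrable lebesgue {-pi..pi} g"

text \<open>The endpoints are lifted to \<open>\<real>\<close>; the interval may straddle any branch point of the angle,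
  and it may be the whole circle with a single point removed.\<close>

definition circle_interval_around :: "real \<Rightarrow> real \<Rightarrow> real \<Rightarrow> bool" where
  "circle_interval_around \<theta>1 a b \<longleftrightarrow> a < \<theta>1 \<and> \<theta>1 < b \<and> b - a \<le> 2 * pi"

definition fourier_cos_coeff :: "(real \<Rightarrow> real) \<Rightarrow> nat \<Rightarrow> real" where
  "fourier_cos_coeff g k = 1 / pi * (LINT \<theta>:{-pi..pi}|lebesgue. g \<theta> * cos (real k * \<theta>))"

definition fourier_sin_coeff :: "(real \<Rightarrow> real) \<Rightarrow> nat \<Rightarrow> real" where
  "fourier_sin_coeff g k = 1 / pi * (LINT \<theta>:{-pi..pi}|lebesgue. g \<theta> * sin (real k * \<theta>))"

definition taylor_coeff :: "(real \<Rightarrow> real) \<Rightarrow> nat \<Rightarrow> complex" where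
  "taylor_coeff g k =
     (if k = 0 then complex_of_real (fourier_cos_coeff g 0 / 2)
      else complex_of_real (fourier_cos_coeff g k) - \<i> * complex_of_real (fourier_sin_coeff g k))"

definition w_gamma :: "(real \<Rightarrow> real) \<Rightarrow> complex \<Rightarrow> complex" where
  "w_gamma g z = (\<Sum>k. taylor_coeff g k * z ^ k)"

definition w_delta :: "complex \<Rightarrow> complex \<Rightarrow> complex" where
  "w_delta z z1 = 1 / (2 * complex_of_real pi) - 1 / complex_of_real pi * (z / (z - z1))"

definition u_delta :: "real \<Rightarrow> real \<Rightarrow> real \<Rightarrow> real" where
  "u_delta \<rho> \<theta> \<theta>1 = Re (w_delta (complex_of_real \<rho> * cis \<theta>) (cis \<theta>1))"

lemma inner_analytic_w_delta: "inner_analytic (\<lambda>z. w_delta z (cis \<theta>1))"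
proof -
  have "z \<noteq> cis \<theta>1" if "z \<in> ball 0 1" for z
    using that by auto
  then show ?thesis
    unfolding inner_analytic_def w_delta_def by (auto intro!: analytic_intros)
qed

lemma norm_fourier_integral_le:
  fixes g h :: "real \<Rightarrow> real"
  assumes g: "set_integrable lebesgue A g" and h: "\<And>x. \<bar>h x\<bar> \<le> 1"
  shows "\<bar>LINT x:A|lebesgue. g x * h x\<bar> \<le> (LINT x:A|lebesgue. \<bar>g x\<bar>)"
proof -
  have "\<bar>LINT x:A|lebesgue. g x * h x\<bar>
          \<le> integral\<^sup>L lebesgue (\<lambda>x. norm (indicator A x *\<^sub>R (g x * h x)))"
    unfolding set_lebesgue_integral_def
    by (metis integral_norm_bound real_norm_def)
  also have "\<dots> \<le> (LINT x:A|lebesgue. \<bar>g x\<bar>)"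
    unfolding set_lebesgue_integral_def
  proof (rule integral_mono')
    show "integrable lebesgue (\<lambda>x. indicator A x *\<^sub>R \<bar>g x\<bar>)"
      using set_integrable_abs[OF g] by (simp add: set_integrable_def)
    show "norm (indicator A x *\<^sub>R (g x * h x)) \<le> indicator A x *\<^sub>R \<bar>g x\<bar>" for x
      using mult_left_mono[OF h[of x], of "\<bar>g x\<bar>"] by (simp add: abs_mult indicator_def)
  qed simp
  finally show ?thesis .
qed

lemma w_gamma_sums:
  assumes g: "circle_integrable g" and z: "norm z < 1"
  shows "(\<lambda>k. taylor_coeff g k * z ^ k) sums w_gamma g z"
proof -
  define M where "M = 1 / pi * (LINT x:{-pi..pi}|lebesgue. \<bar>g x\<bar>)"
  have gi: "set_integrable lebesgue {-pi..pi} g"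
    using g by (simp add: circle_integrable_def)
  have c: "\<bar>fourier_cos_coeff g k\<bar> \<le> M" for k
    using norm_fourier_integral_le[OF gi, of "\<lambda>x. cos (real k * x)"]
    by (simp add: fourier_cos_coeff_def M_def abs_mult divide_right_mono)
  have s: "\<bar>fourier_sin_coeff g k\<bar> \<le> M" for k
    using norm_fourier_integral_le[OF gi, of "\<lambda>x. sin (real k * x)"]
    by (simp add: fourier_sin_coeff_def M_def abs_mult divide_right_mono)
  have M0: "M \<ge> 0" using c[of 0] by linarith
  have b: "norm (taylor_coeff g k) \<le> 2 * M" for k
  proof (cases "k = 0")
    case True
    then show ?thesis using c[of 0] M0 by (simp add: taylor_coeff_def)
  next
    case False
    have "norm (taylor_coeff g k) \<le> \<bar>fourier_cos_coeff g k\<bar> + \<bar>fourier_sin_coeff g k\<bar>"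
      using False norm_triangle_ineq4[of "complex_of_real (fourier_cos_coeff g k)"
          "\<i> * complex_of_real (fourier_sin_coeff g k)"]
      by (simp add: taylor_coeff_def norm_mult)
    then show ?thesis using c[of k] s[of k] by linarith
  qed
  have "summable (\<lambda>k. taylor_coeff g k * z ^ k)"
  proof (rule summable_comparison_test')
    show "summable (\<lambda>k. 2 * M * norm z ^ k)"
      using z by (intro summable_mult summable_geometric) simp
    show "norm (taylor_coeff g k * z ^ k) \<le> 2 * M * norm z ^ k" if "k \<ge> 0" for k
      using b[of k] by (simp add: norm_mult norm_power mult_right_mono)
  qed
  then show ?thesis unfolding w_gamma_def by (rule summable_sums)
qed

lemma inner_analytic_w_gamma: "circle_integrable g \<Longrightarrow> inner_analytic (w_gamma g)"
  unfolding inner_analytic_def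
  by (rule power_series_analytic[of _ _ "taylor_coeff g"]) (simp add: w_gamma_sums)

end

theory Submission
  imports Defs "HOL-Real_Asymp.Real_Asymp"
begin

text \<open>
  The real part \<open>u_delta \<rho> \<theta> c\<close> is the Poisson kernel
  \<open>(1 - \<rho>\<^sup>2) / (2 \<pi> \<bar>1 - \<rho> e\<^bsup>i(\<theta> - c)\<^esup>\<bar>\<^sup>2)\<close>
  (\<open>u_delta_eq_poisson_kernel\<close>), and all four properties come from the behaviour of this
  explicit kernel as \<open>\<rho>\<close> tends to \<open>1\<close>. It is nonnegative. At a positive distance from
  the peak \<open>c\<close> its denominator stays away from zero while its numerator vanishes, so it
  tends to zero there uniformly (\<open>u_delta_le_away_from_peak\<close>). At the peak itself it is
  \<open>(1 + \<rho>) / (2 \<pi> (1 - \<rho>))\<close>, which is unbounded. On a window \<open>[c - d, c + d]\<close>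
  with \<open>d < \<pi>\<close> the half-angle substitution gives an antiderivative, so that the mass of
  the window is \<open>(2 / \<pi>) arctan (((1 + \<rho>) / (1 - \<rho>)) tan (d / 2))\<close>
  (\<open>has_integral_u_delta_around_peak\<close>); it is at most \<open>1\<close> and tends to \<open>1\<close>.

  So the kernels form an approximate identity. The integral of \<open>g \<theta> u_delta \<rho> \<theta> c\<close> over
  an interval around \<open>c\<close> differs from \<open>g c\<close> by a contribution from outside the window,
  which vanishes by the uniform decay; the oscillation of \<open>g\<close> in the window, which is small by
  continuity; and the defect of the window's mass from \<open>1\<close>
  (\<open>tendsto_integral_mult_u_delta\<close>). The normalization of the kernel is the case
  \<open>g = 1\<close> of this statement.
\<close>

section \<open>The Poisson kernel\<close>

text \<open>With \<open>w = \<rho> e\<^bsup>i(\<theta> - c)\<^esup>\<close> the function \<open>w_delta\<close> becomes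
  \<open>(1 + w) / (2 \<pi> (1 - w))\<close>. The denominator \<open>\<bar>1 - w\<bar>\<^sup>2\<close> is split into two
  nonnegative terms: the first makes it positive for \<open>\<rho> < 1\<close>, and the second bounds it
  below uniformly in \<open>\<rho>\<close> away from the peak.\<close>

lemma u_delta_eq_poisson_kernel:
  assumes "0 \<le> \<rho>" "\<rho> < 1"
  shows "u_delta \<rho> \<theta> c = (1 - \<rho>\<^sup>2) / (2 * pi * ((1 - \<rho>)\<^sup>2 + 2 * \<rho> * (1 - cos (\<theta> - c))))"
proof -
  define x where "x = \<theta> - c"
  define w where "w = complex_of_real \<rho> * cis x"
  have "norm w < 1" using assms by (simp add: w_def norm_mult)
  then have w1: "1 - w \<noteq> 0" by auto
  have Re_real_mult: "Re (complex_of_real r * v) = r * Re v" for r v by simp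
  have zw: "complex_of_real \<rho> * cis \<theta> = w * cis c"
    by (simp add: w_def x_def cis_mult mult.assoc)
  have "w_delta (complex_of_real \<rho> * cis \<theta>) (cis c) = 1 / (2 * complex_of_real pi) - 1 / complex_of_real pi * (w / (w - 1))"
  proof -
    have "w * cis c / (w * cis c - cis c) = w / (w - 1)"
      by (simp add: left_diff_distrib[of w 1 "cis c", symmetric, simplified])
    then show ?thesis by (simp add: w_delta_def zw)
  qed
  also have "\<dots> = complex_of_real (1 / (2 * pi)) * ((1 + w) / (1 - w))"
    using w1 by (simp add: divide_simps) (simp add: algebra_simps)
  finally have "u_delta \<rho> \<theta> c = 1 / (2 * pi) * Re ((1 + w) / (1 - w))"
    unfolding u_delta_def by (simp only: Re_real_mult)
  also have "Re ((1 + w) / (1 - w)) = (1 - \<rho>\<^sup>2) / ((1 - \<rho>)\<^sup>2 + 2 * \<rho> * (1 - cos x))"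
  proof -
    have s: "(sin x)\<^sup>2 = 1 - (cos x)\<^sup>2" by (simp add: sin_squared_eq)
    have "(1 + \<rho> * cos x) * (1 - \<rho> * cos x) - (\<rho> * sin x) * (\<rho> * sin x) = 1 - \<rho>\<^sup>2"
      using s by algebra
    moreover have "(1 - \<rho> * cos x)\<^sup>2 + (\<rho> * sin x)\<^sup>2 = (1 - \<rho>)\<^sup>2 + 2 * \<rho> * (1 - cos x)"
      using s by algebra
    ultimately show ?thesis by (simp add: Re_divide w_def)
  qed
  finally show ?thesis by (simp add: x_def)
qed

lemma poisson_denominator_pos:
  fixes \<rho> :: real
  assumes "0 \<le> \<rho>" "\<rho> < 1"
  shows "0 < (1 - \<rho>)\<^sup>2 + 2 * \<rho> * (1 - cos x)"
proof -
  have "0 < (1 - \<rho>)\<^sup>2" using assms by simp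
  moreover have "0 \<le> 2 * \<rho> * (1 - cos x)" using assms by simp
  ultimately show ?thesis by linarith
qed

lemma u_delta_nonneg:
  assumes "0 \<le> \<rho>" "\<rho> < 1"
  shows "0 \<le> u_delta \<rho> \<theta> c"
proof -
  have "\<rho>\<^sup>2 \<le> 1" using assms by (simp add: power_le_one)
  then show ?thesis
    using poisson_denominator_pos[OF assms, of "\<theta> - c"]
    by (simp add: u_delta_eq_poisson_kernel[OF assms])
qed

lemma continuous_on_u_delta:
  assumes "0 \<le> \<rho>" "\<rho> < 1"
  shows "continuous_on A (\<lambda>\<theta>. u_delta \<rho> \<theta> c)"
  unfolding u_delta_eq_poisson_kernel[OF assms]
  using poisson_denominator_pos[OF assms]
  by (intro continuous_intros) (simp add: less_imp_neq[symmetric])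

text \<open>Taking \<open>\<rho> \<ge> 1/2\<close> makes the coefficient \<open>2 \<rho>\<close> of \<open>1 - cos (\<theta> - c)\<close>
  at least \<open>1\<close>, so the denominator has a lower bound free of \<open>\<rho>\<close>. The distance from the
  peak enters only through \<open>m\<close>, which treats an angle and its translates by \<open>2 \<pi>\<close>
  alike.\<close>

lemma u_delta_le_away_from_peak:
  assumes "1 / 2 \<le> \<rho>" "\<rho> < 1" "cos (\<theta> - c) \<le> m" "m < 1"
  shows "u_delta \<rho> \<theta> c \<le> (1 - \<rho>\<^sup>2) / (2 * pi * (1 - m))"
proof -
  have "1 * (1 - m) \<le> (2 * \<rho>) * (1 - cos (\<theta> - c))"
    using assms by (intro mult_mono) auto
  then have "1 - m \<le> (1 - \<rho>)\<^sup>2 + 2 * \<rho> * (1 - cos (\<theta> - c))"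
    by (smt (verit) zero_le_power2)
  moreover have "\<rho>\<^sup>2 \<le> 1" using assms by (simp add: power_le_one)
  ultimately show ?thesis
    using assms by (subst u_delta_eq_poisson_kernel) (auto intro!: divide_left_mono mult_left_mono)
qed

section \<open>The mass near the peak\<close>

text \<open>In the variable \<open>tan ((\<theta> - c) / 2)\<close> the kernel is a Cauchy density of width
  \<open>(1 - \<rho>) / (1 + \<rho>)\<close>. The condition \<open>d < \<pi>\<close> keeps the half angle inside the
  interval where the tangent is smooth.\<close>

lemma has_integral_u_delta_around_peak:
  assumes \<rho>: "0 \<le> \<rho>" "\<rho> < 1" and d: "0 < d" "d < pi"
  shows "((\<lambda>\<theta>. u_delta \<rho> \<theta> c) has_integral
           2 / pi * arctan ((1 + \<rho>) / (1 - \<rho>) * tan (d / 2))) {c - d..c + d}"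
proof -
  define F where "F = (\<lambda>\<theta>. 1 / pi * arctan ((1 + \<rho>) / (1 - \<rho>) * tan ((\<theta> - c) / 2)))"
  have "(F has_vector_derivative u_delta \<rho> \<theta> c) (at \<theta> within {c - d..c + d})"
    if "\<theta> \<in> {c - d..c + d}" for \<theta>
  proof -
    define C where "C = cos ((\<theta> - c) / 2)"
    define S where "S = sin ((\<theta> - c) / 2)"
    have "- (pi / 2) < (\<theta> - c) / 2" "(\<theta> - c) / 2 < pi / 2" using that d by auto
    then have C0: "C \<noteq> 0" unfolding C_def using cos_gt_zero_pi by fastforce
    have CS: "C\<^sup>2 + S\<^sup>2 = 1" by (simp add: C_def S_def)
    have cosx: "cos (\<theta> - c) = C\<^sup>2 - S\<^sup>2"
      using cos_double[of "(\<theta> - c) / 2"] unfolding C_def S_def by (simp only: field_sum_of_halves mult_2)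
    have den: "(1 - \<rho>)\<^sup>2 + 2 * \<rho> * (1 - cos (\<theta> - c)) = (1 - \<rho>)\<^sup>2 * C\<^sup>2 + (1 + \<rho>)\<^sup>2 * S\<^sup>2"
      unfolding cosx using CS by algebra
    have pos: "(1 - \<rho>)\<^sup>2 * C\<^sup>2 + (1 + \<rho>)\<^sup>2 * S\<^sup>2 \<noteq> 0"
      using poisson_denominator_pos[OF \<rho>, of "\<theta> - c"] den by simp
    have SC: "S / C = tan ((\<theta> - c) / 2)" by (simp add: tan_def C_def S_def)
    have "((\<lambda>\<theta>. tan ((\<theta> - c) / 2)) has_real_derivative inverse (C\<^sup>2) * (1 / 2)) (at \<theta>)"
      using C0 unfolding C_def by (auto intro!: derivative_eq_intros)
    then have deriv: "(F has_real_derivative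
        1 / pi * (inverse (1 + ((1 + \<rho>) / (1 - \<rho>) * (S / C))\<^sup>2)
          * ((1 + \<rho>) / (1 - \<rho>) * (inverse (C\<^sup>2) * (1 / 2))))) (at \<theta>)"
      unfolding F_def SC
      by (intro DERIV_cmult DERIV_chain2[OF DERIV_arctan])
    have cancel: "1 / pi * (inverse (N / (R * Q)) * (K * (inverse Q * (1 / 2)))) = K * R / (2 * pi * N)"
      if "Q \<noteq> 0" for K N R Q :: real
      using that by (simp add: inverse_eq_divide mult.commute)
    have "1 + ((1 + \<rho>) / (1 - \<rho>) * (S / C))\<^sup>2
        = ((1 - \<rho>)\<^sup>2 * C\<^sup>2 + (1 + \<rho>)\<^sup>2 * S\<^sup>2) / ((1 - \<rho>)\<^sup>2 * C\<^sup>2)"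
      using C0 \<rho> by (simp add: power_mult_distrib power_divide divide_simps)
    then have "1 / pi * (inverse (1 + ((1 + \<rho>) / (1 - \<rho>) * (S / C))\<^sup>2)
          * ((1 + \<rho>) / (1 - \<rho>) * (inverse (C\<^sup>2) * (1 / 2))))
        = (1 + \<rho>) / (1 - \<rho>) * (1 - \<rho>)\<^sup>2 / (2 * pi * ((1 - \<rho>)\<^sup>2 * C\<^sup>2 + (1 + \<rho>)\<^sup>2 * S\<^sup>2))"
      using C0 by (simp only: cancel power_not_zero not_False_eq_True)
    also have "(1 + \<rho>) / (1 - \<rho>) * (1 - \<rho>)\<^sup>2 = 1 - \<rho>\<^sup>2"
      using \<rho> by (simp add: power2_eq_square divide_simps) (simp add: algebra_simps)
    also have "(1 - \<rho>\<^sup>2) / (2 * pi * ((1 - \<rho>)\<^sup>2 * C\<^sup>2 + (1 + \<rho>)\<^sup>2 * S\<^sup>2)) = u_delta \<rho> \<theta> c"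
      by (simp add: u_delta_eq_poisson_kernel[OF \<rho>] den)
    finally show ?thesis
      using deriv has_field_derivative_at_within has_real_derivative_iff_has_vector_derivative
      by metis
  qed
  then have "((\<lambda>\<theta>. u_delta \<rho> \<theta> c) has_integral F (c + d) - F (c - d)) {c - d..c + d}"
    using d by (intro fundamental_theorem_of_calculus) auto
  then show ?thesis by (simp add: F_def arctan_minus)
qed

lemma tendsto_u_delta_mass_around_peak:
  assumes "0 < d" "d < pi"
  shows "((\<lambda>\<rho>. 2 / pi * arctan ((1 + \<rho>) / (1 - \<rho>) * tan (d / 2))) \<longlongrightarrow> 1) (at_left 1)"
proof -
  have t: "0 < tan (d / 2)" using assms by (intro tan_gt_zero) auto
  have "filterlim (\<lambda>\<rho>::real. (1 + \<rho>) / (1 - \<rho>)) at_top (at_left 1)" by real_asymp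
  then have "filterlim (\<lambda>\<rho>. (1 + \<rho>) / (1 - \<rho>) * tan (d / 2)) at_top (at_left 1)"
    by (rule filterlim_at_top_mult_tendsto_pos[OF tendsto_const t])
  then have "((\<lambda>\<rho>. arctan ((1 + \<rho>) / (1 - \<rho>) * tan (d / 2))) \<longlongrightarrow> pi / 2) (at_left 1)"
    by (rule filterlim_compose[OF tendsto_arctan_at_top])
  from tendsto_mult[OF tendsto_const[of "2 / pi"] this] show ?thesis by simp
qed

section \<open>The approximate identity\<close>

text \<open>An interval of length at most \<open>2 \<pi>\<close> around \<open>c\<close> may come close to a translate
  \<open>c \<plusminus> 2 \<pi>\<close> of the peak. The upper bound on \<open>\<bar>x\<bar>\<close> keeps the distance \<open>d\<close>
  from those translates too.\<close>

lemma cos_le_cos_away_from_multiples_of_2pi: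
  assumes "0 \<le> d" "d \<le> \<bar>x\<bar>" "\<bar>x\<bar> \<le> 2 * pi - d"
  shows "cos x \<le> cos d"
proof (cases "\<bar>x\<bar> \<le> pi")
  case True
  then show ?thesis using cos_monotone_0_pi_le[of d "\<bar>x\<bar>"] assms by simp
next
  case False
  then have "cos (2 * pi - \<bar>x\<bar>) \<le> cos d" using assms by (intro cos_monotone_0_pi_le) auto
  then show ?thesis by (simp add: cos_diff)
qed

lemma set_lebesgue_integral_open_interval_continuous:
  fixes f :: "real \<Rightarrow> real"
  assumes "continuous_on {a..b} f"
  shows "(LINT x:{a<..<b}|lebesgue. f x) = integral {a..b} f"
proof -
  have "set_integrable lebesgue {a..b} f"
    using absolutely_integrable_continuous_real[OF assms] .
  then have "set_integrable lebesgue {a<..<b} f"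
    by (rule set_integrable_subset) auto
  then show ?thesis
    by (simp add: set_lebesgue_integral_eq_integral integral_open_interval_real)
qed

lemma abs_integral_u_delta_away_from_peak_le:
  fixes g :: "real \<Rightarrow> real"
  assumes \<rho>: "1 / 2 \<le> \<rho>" "\<rho> < 1" and m: "m < 1" and "l \<le> r" "0 \<le> M"
    and g: "continuous_on {l..r} g"
    and bound: "\<And>\<theta>. \<theta> \<in> {l..r} \<Longrightarrow> \<bar>g \<theta>\<bar> \<le> M \<and> cos (\<theta> - c) \<le> m"
  shows "\<bar>integral {l..r} (\<lambda>\<theta>. g \<theta> * u_delta \<rho> \<theta> c)\<bar>
    \<le> M * ((1 - \<rho>\<^sup>2) / (2 * pi * (1 - m))) * (r - l)"
proof -
  have "norm (integral {l..r} (\<lambda>\<theta>. g \<theta> * u_delta \<rho> \<theta> c))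
    \<le> M * ((1 - \<rho>\<^sup>2) / (2 * pi * (1 - m))) * (r - l)"
  proof (rule integral_bound)
    show "continuous_on {l..r} (\<lambda>\<theta>. g \<theta> * u_delta \<rho> \<theta> c)"
      using g \<rho> by (intro continuous_on_mult continuous_on_u_delta) auto
    show "norm (g \<theta> * u_delta \<rho> \<theta> c) \<le> M * ((1 - \<rho>\<^sup>2) / (2 * pi * (1 - m)))"
      if "\<theta> \<in> {l..r}" for \<theta>
    proof -
      have u: "0 \<le> u_delta \<rho> \<theta> c" "u_delta \<rho> \<theta> c \<le> (1 - \<rho>\<^sup>2) / (2 * pi * (1 - m))"
        using bound[OF that] \<rho> m by (auto intro!: u_delta_nonneg u_delta_le_away_from_peak)
      have "\<bar>g \<theta>\<bar> * u_delta \<rho> \<theta> c \<le> M * ((1 - \<rho>\<^sup>2) / (2 * pi * (1 - m)))"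
        using bound[OF that] u \<open>0 \<le> M\<close> by (intro mult_mono) auto
      then show ?thesis using u(1) by (simp add: abs_mult)
    qed
  qed fact
  then show ?thesis by simp
qed

text \<open>An interval of length at most \<open>2 \<pi>\<close> with \<open>c\<close> in its interior contains no
  other peak of the periodic kernel, so nothing but \<open>g c\<close> survives in the limit.\<close>

lemma tendsto_integral_mult_u_delta:
  fixes g :: "real \<Rightarrow> real"
  assumes ab: "circle_interval_around c a b" and g: "continuous_on {a..b} g"
  shows "((\<lambda>\<rho>. LINT \<theta>:{a<..<b}|lebesgue. g \<theta> * u_delta \<rho> \<theta> c) \<longlongrightarrow> g c) (at_left 1)"
proof (rule tendstoI)
  fix e :: real assume e: "0 < e"
  have ac: "a < c" "c < b" "b - a \<le> 2 * pi"
    using ab by (auto simp: circle_interval_around_def)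
  obtain M where M: "0 \<le> M" "\<And>\<theta>. \<theta> \<in> {a..b} \<Longrightarrow> \<bar>g \<theta>\<bar> \<le> M"
  proof -
    have "bounded (g ` {a..b})"
      using compact_continuous_image[OF g] by (simp add: compact_imp_bounded)
    then obtain K where "0 < K" "\<And>\<theta>. \<theta> \<in> {a..b} \<Longrightarrow> \<bar>g \<theta>\<bar> \<le> K"
      unfolding bounded_pos by auto
    then show ?thesis using that[of K] by simp
  qed
  obtain d0 where d0: "0 < d0" "\<And>\<theta>. \<theta> \<in> {a..b} \<Longrightarrow> \<bar>\<theta> - c\<bar> < d0 \<Longrightarrow> \<bar>g \<theta> - g c\<bar> < e / 2"
    using g[unfolded continuous_on_iff, rule_format, of c "e / 2"] e ac
    by (auto simp: dist_real_def)
  (* The window has to fit into the interval on both sides: as b - a is at most 2 pi, the rest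
     of the interval then also keeps the distance d from c - 2 pi and c + 2 pi. The bound pi / 2
     stays strictly below pi, and d0 / 2 strictly below d0. *)
  define d where "d = min (min (d0 / 2) (pi / 2)) (min (c - a) (b - c))"
  have d: "0 < d" "d < d0" "d < pi" "a \<le> c - d" "c + d \<le> b"
    using d0 ac by (auto simp: d_def min_def)
  define m where "m = cos d"
  have m: "m < 1" using cos_monotone_0_pi[of 0 d] d by (simp add: m_def)
  define A where "A = (\<lambda>\<rho>. 2 / pi * arctan ((1 + \<rho>) / (1 - \<rho>) * tan (d / 2)))"
  define E where "E = (\<lambda>\<rho>::real. M * ((1 - \<rho>\<^sup>2) / (2 * pi * (1 - m))) * (b - a))"
  have bound: "\<bar>(LINT \<theta>:{a<..<b}|lebesgue. g \<theta> * u_delta \<rho> \<theta> c) - g c\<bar>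
      \<le> E \<rho> + e / 2 + M * \<bar>A \<rho> - 1\<bar>" if \<rho>: "1 / 2 < \<rho>" "\<rho> < 1" for \<rho>
  proof -
    have \<rho>': "0 \<le> \<rho>" "1 / 2 \<le> \<rho>" using \<rho> by auto
    let ?f = "\<lambda>\<theta>. g \<theta> * u_delta \<rho> \<theta> c"
    let ?K = "M * ((1 - \<rho>\<^sup>2) / (2 * pi * (1 - m)))"
    have gsub: "continuous_on {l..r} g" if "a \<le> l" "r \<le> b" for l r
      using that by (intro continuous_on_subset[OF g]) auto
    have fcont: "continuous_on {l..r} ?f" if "a \<le> l" "r \<le> b" for l r
      using gsub[OF that] \<rho>' \<rho> by (intro continuous_on_mult continuous_on_u_delta) auto
    have "\<bar>integral {a..c - d} ?f\<bar> \<le> ?K * (c - d - a)"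
      using \<rho>' \<rho> m M d ac unfolding m_def
      by (intro abs_integral_u_delta_away_from_peak_le gsub conjI
          cos_le_cos_away_from_multiples_of_2pi) auto
    moreover have "\<bar>integral {c + d..b} ?f\<bar> \<le> ?K * (b - (c + d))"
      using \<rho>' \<rho> m M d ac unfolding m_def
      by (intro abs_integral_u_delta_away_from_peak_le gsub conjI
          cos_le_cos_away_from_multiples_of_2pi) auto
    moreover have "?K * (c - d - a) + ?K * (b - (c + d)) \<le> E \<rho>"
    proof -
      have "0 \<le> ?K" using M m \<rho>' \<rho> by (simp add: power_le_one)
      moreover have "?K * (c - d - a) + ?K * (b - (c + d)) = ?K * (b - a - 2 * d)"
        unfolding distrib_left[symmetric] by (rule arg_cong[where f = "(*) ?K"]) simp
      ultimately show ?thesis unfolding E_def using d mult_left_mono[of "b - a - 2 * d" "b - a" ?K] by linarith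
    qed
    moreover have "\<bar>integral {c - d..c + d} ?f - g c * A \<rho>\<bar> \<le> e / 2"
    proof -
      have u: "((\<lambda>\<theta>. u_delta \<rho> \<theta> c) has_integral A \<rho>) {c - d..c + d}"
        unfolding A_def using \<rho>' \<rho> d by (intro has_integral_u_delta_around_peak) auto
      have f: "(?f has_integral integral {c - d..c + d} ?f) {c - d..c + d}"
        using fcont[of "c - d" "c + d"] d
        by (intro integrable_integral integrable_continuous_interval) auto
      have h: "((\<lambda>\<theta>. ?f \<theta> - g c * u_delta \<rho> \<theta> c) has_integral
          integral {c - d..c + d} ?f - g c * A \<rho>) {c - d..c + d}"
        by (intro has_integral_diff f has_integral_mult_right u)
      have "norm (integral {c - d..c + d} ?f - g c * A \<rho>)
        \<le> integral {c - d..c + d} (\<lambda>\<theta>. e / 2 * u_delta \<rho> \<theta> c)"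
        unfolding integral_unique[OF h, symmetric]
      proof (rule integral_norm_bound_integral)
        show "norm (?f \<theta> - g c * u_delta \<rho> \<theta> c) \<le> e / 2 * u_delta \<rho> \<theta> c"
          if "\<theta> \<in> {c - d..c + d}" for \<theta>
        proof -
          have "\<bar>g \<theta> - g c\<bar> \<le> e / 2"
            using that d by (intro less_imp_le d0) auto
          then have "\<bar>g \<theta> - g c\<bar> * u_delta \<rho> \<theta> c \<le> e / 2 * u_delta \<rho> \<theta> c"
            using u_delta_nonneg[of \<rho> \<theta> c] \<rho>' \<rho> by (intro mult_right_mono) auto
          then show ?thesis
            using u_delta_nonneg[of \<rho> \<theta> c] \<rho>' \<rho>
            by (simp add: left_diff_distrib[symmetric] abs_mult)
        qed
      qed (use h u in \<open>auto intro!: integrable_on_mult_right simp: has_integral_integrable\<close>)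
      also have "\<dots> = e / 2 * A \<rho>" using integral_unique[OF has_integral_mult_right[OF u]] .
      also have "\<dots> \<le> e / 2"
        using arctan_ubound[of "(1 + \<rho>) / (1 - \<rho>) * tan (d / 2)"] e
        by (simp add: A_def divide_simps)
      finally show ?thesis by simp
    qed
    moreover have "\<bar>g c * A \<rho> - g c\<bar> \<le> M * \<bar>A \<rho> - 1\<bar>"
    proof -
      have "g c * A \<rho> - g c = g c * (A \<rho> - 1)" by (simp add: algebra_simps)
      then show ?thesis using M(2)[of c] ac by (simp add: abs_mult mult_right_mono)
    qed
    moreover have "(LINT \<theta>:{a<..<b}|lebesgue. ?f \<theta>)
      = integral {a..c - d} ?f + integral {c - d..c + d} ?f + integral {c + d..b} ?f"
    proof -
      have int: "?f integrable_on {a..b}" "?f integrable_on {a..c + d}"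
        using d by (intro integrable_continuous_interval fcont; simp)+
      show ?thesis
        using Henstock_Kurzweil_Integration.integral_combine[OF _ _ int(1), of "c + d"]
          Henstock_Kurzweil_Integration.integral_combine[OF _ _ int(2), of "c - d"] d ac
        by (simp add: set_lebesgue_integral_open_interval_continuous[OF fcont])
    qed
    ultimately show ?thesis by linarith
  qed
  have "((\<lambda>\<rho>. E \<rho> + e / 2 + M * \<bar>A \<rho> - 1\<bar>) \<longlongrightarrow> E 1 + e / 2 + M * \<bar>1 - 1\<bar>) (at_left 1)"
    unfolding E_def A_def using m
    by (intro tendsto_intros tendsto_u_delta_mass_around_peak d) auto
  then have "\<forall>\<^sub>F \<rho> in at_left 1. E \<rho> + e / 2 + M * \<bar>A \<rho> - 1\<bar> < e"
    by (rule order_tendstoD) (use e in \<open>simp add: E_def\<close>)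
  moreover have "\<forall>\<^sub>F \<rho> in at_left (1::real). 1 / 2 < \<rho> \<and> \<rho> < 1"
    using eventually_at_left_real[of "1 / 2" "1::real"] by simp
  ultimately show "\<forall>\<^sub>F \<rho> in at_left 1.
      dist (LINT \<theta>:{a<..<b}|lebesgue. g \<theta> * u_delta \<rho> \<theta> c) (g c) < e"
    by eventually_elim (use bound in \<open>force simp: dist_real_def\<close>)
qed

section \<open>Pointwise limits and the delta function\<close>

lemma tendsto_u_delta_away_from_peak:
  assumes "cos (\<theta> - c) < 1"
  shows "((\<lambda>\<rho>. u_delta \<rho> \<theta> c) \<longlongrightarrow> 0) (at_left 1)"
proof (rule tendsto_sandwich)
  have ev: "\<forall>\<^sub>F \<rho> in at_left (1::real). 1 / 2 < \<rho> \<and> \<rho> < 1"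
    using eventually_at_left_real[of "1 / 2" "1::real"] by simp
  show "\<forall>\<^sub>F \<rho> in at_left 1. 0 \<le> u_delta \<rho> \<theta> c"
    using ev by eventually_elim (simp add: u_delta_nonneg)
  show "\<forall>\<^sub>F \<rho> in at_left 1. u_delta \<rho> \<theta> c \<le> (1 - \<rho>\<^sup>2) / (2 * pi * (1 - cos (\<theta> - c)))"
    using ev by eventually_elim (use assms in \<open>simp add: u_delta_le_away_from_peak\<close>)
  have "((\<lambda>\<rho>. (1 - \<rho>\<^sup>2) / (2 * pi * (1 - cos (\<theta> - c))))
      \<longlongrightarrow> (1 - 1\<^sup>2) / (2 * pi * (1 - cos (\<theta> - c)))) (at_left 1)"
    using assms by (intro tendsto_intros) auto
  then show "((\<lambda>\<rho>. (1 - \<rho>\<^sup>2) / (2 * pi * (1 - cos (\<theta> - c)))) \<longlongrightarrow> 0) (at_left 1)"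
    by simp
qed simp

lemma filterlim_u_delta_at_peak: "filterlim (\<lambda>\<rho>. u_delta \<rho> c c) at_top (at_left 1)"
proof -
  have "filterlim (\<lambda>\<rho>::real. (1 - \<rho>\<^sup>2) / (2 * pi * (1 - \<rho>)\<^sup>2)) at_top (at_left 1)"
    by real_asymp
  moreover have "\<forall>\<^sub>F \<rho> in at_left (1::real). 0 < \<rho> \<and> \<rho> < 1"
    using eventually_at_left_real[of 0 "1::real"] by simp
  then have "\<forall>\<^sub>F \<rho> in at_left 1. (1 - \<rho>\<^sup>2) / (2 * pi * (1 - \<rho>)\<^sup>2) = u_delta \<rho> c c"
    by eventually_elim (simp add: u_delta_eq_poisson_kernel)
  ultimately show ?thesis by (rule filterlim_cong[OF refl refl, THEN iffD1, rotated])
qed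

theorem theorem1:
  fixes \<theta>1 :: real
  shows
    "(\<forall>\<theta>::real. (\<nexists>n::int. \<theta> = \<theta>1 + 2 * pi * of_int n) \<longrightarrow>
        ((\<lambda>\<rho>. u_delta \<rho> \<theta> \<theta>1) \<longlongrightarrow> 0) (at_left 1))
   \<and> filterlim (\<lambda>\<rho>. u_delta \<rho> \<theta>1 \<theta>1) at_top (at_left 1)
   \<and> (\<forall>a b :: real. circle_interval_around \<theta>1 a b \<longrightarrow>
        ((\<lambda>\<rho>. LINT \<theta>:{a<..<b}|lebesgue. u_delta \<rho> \<theta> \<theta>1) \<longlongrightarrow> 1) (at_left 1))
   \<and> (\<forall>g :: real \<Rightarrow> real.
        circle_integrable g \<and> continuous_on UNIV g \<and>
        (\<exists>L. (w_gamma g \<longlongrightarrow> L) (at (cis \<theta>1) within ball 0 1)) \<longrightarrow>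
        (\<forall>a b :: real. circle_interval_around \<theta>1 a b \<longrightarrow>
          ((\<lambda>\<rho>. LINT \<theta>:{a<..<b}|lebesgue. g \<theta> * u_delta \<rho> \<theta> \<theta>1)
             \<longlongrightarrow> g \<theta>1) (at_left 1)))"
proof (intro conjI allI impI)
  fix \<theta> :: real
  assume "\<nexists>n::int. \<theta> = \<theta>1 + 2 * pi * of_int n"
  then have "cos (\<theta> - \<theta>1) \<noteq> 1"
    unfolding cos_one_2pi_int by (auto simp: algebra_simps)
  then have "cos (\<theta> - \<theta>1) < 1"
    using cos_le_one[of "\<theta> - \<theta>1"] by linarith
  then show "((\<lambda>\<rho>. u_delta \<rho> \<theta> \<theta>1) \<longlongrightarrow> 0) (at_left 1)"
    by (rule tendsto_u_delta_away_from_peak)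
next
  show "filterlim (\<lambda>\<rho>. u_delta \<rho> \<theta>1 \<theta>1) at_top (at_left 1)"
    by (rule filterlim_u_delta_at_peak)
next
  fix a b :: real
  assume "circle_interval_around \<theta>1 a b"
  from tendsto_integral_mult_u_delta[OF this, of "\<lambda>_. 1"]
  show "((\<lambda>\<rho>. LINT \<theta>:{a<..<b}|lebesgue. u_delta \<rho> \<theta> \<theta>1) \<longlongrightarrow> 1) (at_left 1)"
    by simp
next
  fix g :: "real \<Rightarrow> real" and a b :: real
  assume "circle_integrable g \<and> continuous_on UNIV g \<and>
      (\<exists>L. (w_gamma g \<longlongrightarrow> L) (at (cis \<theta>1) within ball 0 1))"
    and ab: "circle_interval_around \<theta>1 a b"
  then have "continuous_on {a..b} g"
    using continuous_on_subset by blast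
  with ab show "((\<lambda>\<rho>. LINT \<theta>:{a<..<b}|lebesgue. g \<theta> * u_delta \<rho> \<theta> \<theta>1) \<longlongrightarrow> g \<theta>1) (at_left 1)"
    by (rule tendsto_integral_mult_u_delta)
qed

end
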